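(* Let $\alpha,\beta,\gamma>-1$ with $\alpha-\beta\notin\mathbb Z$. For the transformation $(\alpha,\beta)\to(\beta,\alpha+1)$ of the Jacobi–Piñeiro systems, the connection matrix $\Omega:=S^{\alpha,\beta}(S^{\beta,\alpha+1})^{-1}$ is lower bidiagonal with $$\Omega_{n,n}=1,\qquad\Omega_{n+1,n}=\frac{H_{n+1}^{\alpha,\beta}}{H_n^{\beta,\alpha+1}},\qquad n\in\mathbb N_0,$$ and all other entries zero. The connection formulas $$\Omega B^{\beta,\alpha+1}=B^{\alpha,\beta},\qquad \Omega^\top A_1^{\alpha,\beta}=x\,A_2^{\beta,\alpha+1},\qquad \Omega^\top A_2^{\alpha,\beta}=A_1^{\beta,\alpha+1},\qquad \Omega^\top Q^{\alpha,\beta}=Q^{\beta,\alpha+1}$$ hold.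
   Context: The Jacobi–Piñeiro system with parameters $(\alpha,\beta)$ (and fixed $\gamma$) consists of the weights $w_1=x^\alpha$, $w_2=x^\beta$ and the measure $\mathrm d\mu=(1-x)^\gamma\,\mathrm dx$ on $\Delta=[0,1]$; it is a perfect system. All vectors and matrices are semi-infinite, indexed by $0,1,2,\dots$. Put $X(x)=(1,x,x^2,\dots)^\top$, $X_1(x)=(1,0,x,0,x^2,0,\dots)^\top$, $X_2(x)=(0,1,0,x,0,x^2,\dots)^\top$. The moment matrix $g^{\alpha,\beta}=\int_0^1X(x)\big(X_1(x)x^\alpha+X_2(x)x^\beta\big)^\top(1-x)^\gamma\,\mathrm dx$ has Gauss–Borel factorization $g^{\alpha,\beta}=(S^{\alpha,\beta})^{-1}H^{\alpha,\beta}(\tilde S^{\alpha,\beta})^{-\top}$ with $S^{\alpha,\beta},\tilde S^{\alpha,\beta}$ lower unitriangular and $H^{\alpha,\beta}=\operatorname{diag}(H^{\alpha,\beta}_0,H^{\alpha,\beta}_1,\dots)$, all entries nonzero. Then $B^{\alpha,\beta}=S^{\alpha,\beta}X$, $A_a^{\alpha,\beta}=(H^{\alpha,\beta})^{-1}\tilde S^{\alpha,\beta}X_a$ ($a\in\{1,2\}$) and $Q^{\alpha,\beta}=x^\alpha A_1^{\alpha,\beta}+x^\beta A_2^{\alpha,\beta}$. The objects with superscript $\beta,\alpha+1$ are those of the system $(x^\beta,x^{\alpha+1},(1-x)^\gamma\mathrm dx)$. *)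

theory Defs
  imports "HOL-Analysis.Analysis" "HOL-Library.Groups_Big_Fun"
begin

type_synonym smat = "nat \<Rightarrow> nat \<Rightarrow> real"
type_synonym svec = "nat \<Rightarrow> real"

text \<open>
  Semi-infinite matrices and vectors are multiplied by purely algebraic sums:
  \<^const>\<open>Sum_any\<close> sums over the support of the summand. In every product below the
  support is finite (it would return 0 for an infinite support), because a left factor
  has finite rows or a right factor has finite columns.
\<close>

definition smat_mult :: "smat \<Rightarrow> smat \<Rightarrow> smat" where
  "smat_mult M N = (\<lambda>i j. Sum_any (\<lambda>k. M i k * N k j))"

definition smat_vec :: "smat \<Rightarrow> svec \<Rightarrow> svec" where
  "smat_vec M v = (\<lambda>i. Sum_any (\<lambda>k. M i k * v k))"

definition smat_transpose :: "smat \<Rightarrow> smat" where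
  "smat_transpose M = (\<lambda>i j. M j i)"

definition smat_diag :: "svec \<Rightarrow> smat" where
  "smat_diag d = (\<lambda>i j. if i = j then d i else 0)"

definition lower_unitriangular :: "smat \<Rightarrow> bool" where
  "lower_unitriangular M \<longleftrightarrow> (\<forall>i. M i i = 1) \<and> (\<forall>i j. i < j \<longrightarrow> M i j = 0)"

text \<open>
  The inverse within the group of lower unitriangular matrices; it is used only for
  matrices of that group, where it exists and is unique.
\<close>

definition smat_inv :: "smat \<Rightarrow> smat" where
  "smat_inv M = (THE N. lower_unitriangular N \<and>
     smat_mult M N = smat_diag (\<lambda>_. 1) \<and> smat_mult N M = smat_diag (\<lambda>_. 1))"

definition gauss_borel :: "smat \<Rightarrow> smat \<Rightarrow> svec \<Rightarrow> smat \<Rightarrow> bool" where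
  "gauss_borel g S H St \<longleftrightarrow>
     lower_unitriangular S \<and> lower_unitriangular St \<and> (\<forall>n. H n \<noteq> 0) \<and>
     g = smat_mult (smat_mult (smat_inv S) (smat_diag H)) (smat_transpose (smat_inv St))"

definition X_vec :: "real \<Rightarrow> svec" where
  "X_vec x = (\<lambda>n. x ^ n)"

definition X1_vec :: "real \<Rightarrow> svec" where
  "X1_vec x = (\<lambda>n. if even n then x ^ (n div 2) else 0)"

definition X2_vec :: "real \<Rightarrow> svec" where
  "X2_vec x = (\<lambda>n. if odd n then x ^ (n div 2) else 0)"

definition jp_moment :: "real \<Rightarrow> real \<Rightarrow> real \<Rightarrow> smat" where
  "jp_moment \<alpha> \<beta> \<gamma> = (\<lambda>i j. integral {0..1}
     (\<lambda>x. X_vec x i * (X1_vec x j * x powr \<alpha> + X2_vec x j * x powr \<beta>) * (1 - x) powr \<gamma>))"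

text \<open>
  A factorization with nonzero diagonal is unique if it exists; it exists for
  \<open>\<alpha>, \<beta>, \<gamma> > -1\<close> and \<open>\<alpha> - \<beta>\<close> not an integer, since the system is then perfect.
  Under these conditions the following three descriptions single out its factors.
\<close>

definition jp_S :: "real \<Rightarrow> real \<Rightarrow> real \<Rightarrow> smat" where
  "jp_S \<alpha> \<beta> \<gamma> = (THE S. \<exists>H St. gauss_borel (jp_moment \<alpha> \<beta> \<gamma>) S H St)"

definition jp_H :: "real \<Rightarrow> real \<Rightarrow> real \<Rightarrow> svec" where
  "jp_H \<alpha> \<beta> \<gamma> = (THE H. \<exists>S St. gauss_borel (jp_moment \<alpha> \<beta> \<gamma>) S H St)"

definition jp_St :: "real \<Rightarrow> real \<Rightarrow> real \<Rightarrow> smat" where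
  "jp_St \<alpha> \<beta> \<gamma> = (THE St. \<exists>S H. gauss_borel (jp_moment \<alpha> \<beta> \<gamma>) S H St)"

definition jp_B :: "real \<Rightarrow> real \<Rightarrow> real \<Rightarrow> real \<Rightarrow> svec" where
  "jp_B \<alpha> \<beta> \<gamma> x = smat_vec (jp_S \<alpha> \<beta> \<gamma>) (X_vec x)"

definition jp_A1 :: "real \<Rightarrow> real \<Rightarrow> real \<Rightarrow> real \<Rightarrow> svec" where
  "jp_A1 \<alpha> \<beta> \<gamma> x =
     smat_vec (smat_mult (smat_diag (\<lambda>n. inverse (jp_H \<alpha> \<beta> \<gamma> n))) (jp_St \<alpha> \<beta> \<gamma>)) (X1_vec x)"

definition jp_A2 :: "real \<Rightarrow> real \<Rightarrow> real \<Rightarrow> real \<Rightarrow> svec" where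
  "jp_A2 \<alpha> \<beta> \<gamma> x =
     smat_vec (smat_mult (smat_diag (\<lambda>n. inverse (jp_H \<alpha> \<beta> \<gamma> n))) (jp_St \<alpha> \<beta> \<gamma>)) (X2_vec x)"

definition jp_Q :: "real \<Rightarrow> real \<Rightarrow> real \<Rightarrow> real \<Rightarrow> svec" where
  "jp_Q \<alpha> \<beta> \<gamma> x = (\<lambda>n. x powr \<alpha> * jp_A1 \<alpha> \<beta> \<gamma> x n + x powr \<beta> * jp_A2 \<alpha> \<beta> \<gamma> x n)"

definition jp_connection :: "real \<Rightarrow> real \<Rightarrow> real \<Rightarrow> smat" where
  "jp_connection \<alpha> \<beta> \<gamma> = smat_mult (jp_S \<alpha> \<beta> \<gamma>) (smat_inv (jp_S \<beta> (\<alpha> + 1) \<gamma>))"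

end

theory Submission
  imports Defs
begin

text \<open>
  Passing from \<open>(\<alpha>, \<beta>)\<close> to \<open>(\<beta>, \<alpha> + 1)\<close> deletes the first column of the moment matrix:
  \<open>g' = g \<Lambda>\<^sup>T\<close> with \<open>\<Lambda>\<close> the shift. Comparing the two factorizations gives
  \<open>\<Omega> = S S'\<inverse> = H F\<^sup>T H'\<inverse>\<close>, where \<open>F = St' \<Lambda> St\<inverse>\<close> is lower Hessenberg with unit
  superdiagonal. As \<open>\<Omega>\<close> is also lower unitriangular, it is bidiagonal, and
  \<open>F St = St' \<Lambda>\<close> together with \<open>\<Lambda> X\<^sub>1 = x X\<^sub>2\<close>, \<open>\<Lambda> X\<^sub>2 = X\<^sub>1\<close> yields the connection
  formulas. The factorizations exist by Gaussian elimination: the moments are values of the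
  Beta function, and their leading principal sections have trivial left kernel.
\<close>

section \<open>Semi-infinite matrices\<close>

notation smat_mult (infixl "\<odot>" 70)

abbreviation smat_one :: smat where
  "smat_one \<equiv> smat_diag (\<lambda>_. 1)"

text \<open>\<open>Sum_any\<close> returns 0 on an infinite support, so associativity can fail;
  finiteness of rows is the side condition that restores it. Finite columns are expressed as
  \<open>row_finite (smat_transpose M)\<close>.\<close>

definition row_finite :: "smat \<Rightarrow> bool" where
  "row_finite M \<longleftrightarrow> (\<forall>i. finite {k. M i k \<noteq> 0})"

lemma lower_unitriangularD:
  assumes "lower_unitriangular M"
  shows "M i i = 1" "i < j \<Longrightarrow> M i j = 0"
  using assms by (auto simp: lower_unitriangular_def)

lemma row_finite_lower_unitriangular: "lower_unitriangular M \<Longrightarrow> row_finite M"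
  unfolding row_finite_def
proof
  fix i assume "lower_unitriangular M"
  then have "{k. M i k \<noteq> 0} \<subseteq> {..i}"
    by (auto simp: lower_unitriangular_def) (meson not_le)
  then show "finite {k. M i k \<noteq> 0}"
    by (rule finite_subset) simp
qed

lemma row_finite_diag: "row_finite (smat_diag d)"
  unfolding row_finite_def
proof
  fix i
  have "{k. smat_diag d i k \<noteq> 0} \<subseteq> {i}" by (auto simp: smat_diag_def)
  then show "finite {k. smat_diag d i k \<noteq> 0}" by (rule finite_subset) simp
qed

lemma smat_transpose_transpose [simp]: "smat_transpose (smat_transpose M) = M"
  by (simp add: smat_transpose_def)

lemma smat_transpose_diag [simp]: "smat_transpose (smat_diag d) = smat_diag d"
  by (auto simp: smat_transpose_def smat_diag_def fun_eq_iff)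

lemma smat_transpose_mult:
  "smat_transpose (M \<odot> N) = smat_transpose N \<odot> smat_transpose M"
  by (simp add: smat_transpose_def smat_mult_def mult.commute)

section \<open>Associativity of semi-infinite products\<close>

lemma smat_mult_sum:
  assumes "finite A" "\<And>k. k \<notin> A \<Longrightarrow> M i k * N k j = 0"
  shows "(M \<odot> N) i j = (\<Sum>k\<in>A. M i k * N k j)"
  unfolding smat_mult_def by (rule Sum_any.expand_superset) (use assms in auto)

text \<open>Once the support \<open>A\<close> of row \<open>i\<close> of \<open>M\<close> is finite
  and each \<open>k\<close> in \<open>A\<close> leaves finitely many \<open>l\<close>, both sides
  are double sums over finite sets and can be interchanged. For \<open>k\<close> outside
  \<open>A\<close> the factor \<open>M i k\<close> is 0, so a default value of
  \<open>N \<odot> P\<close> there is harmless.\<close>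

lemma smat_mult_assoc_entry:
  assumes fin: "finite {k. M i k \<noteq> 0}"
    and fin': "\<And>k. M i k \<noteq> 0 \<Longrightarrow> finite {l. N k l * P l j \<noteq> 0}"
  shows "((M \<odot> N) \<odot> P) i j = (M \<odot> (N \<odot> P)) i j"
proof -
  define A where "A = {k. M i k \<noteq> 0}"
  define B where "B = (\<Union>k\<in>A. {l. N k l * P l j \<noteq> 0})"
  have A: "finite A" and B: "finite B"
    using fin fin' by (auto simp: A_def B_def)
  have MN: "(M \<odot> N) i l = (\<Sum>k\<in>A. M i k * N k l)" for l
    by (rule smat_mult_sum [OF A]) (auto simp: A_def)
  have NP: "(N \<odot> P) k j = (\<Sum>l\<in>B. N k l * P l j)" if "k \<in> A" for k
    by (rule smat_mult_sum [OF B]) (use that in \<open>auto simp: B_def\<close>)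
  have "((M \<odot> N) \<odot> P) i j = (\<Sum>l\<in>B. (M \<odot> N) i l * P l j)"
  proof (rule smat_mult_sum [OF B])
    fix l assume "l \<notin> B"
    then have "(\<Sum>k\<in>A. M i k * N k l * P l j) = 0"
      by (intro sum.neutral) (auto simp: B_def)
    then show "(M \<odot> N) i l * P l j = 0"
      by (simp add: MN sum_distrib_right)
  qed
  also have "\<dots> = (\<Sum>k\<in>A. M i k * (\<Sum>l\<in>B. N k l * P l j))"
    by (simp add: MN sum_distrib_right sum_distrib_left mult.assoc) (rule sum.swap)
  also have "\<dots> = (\<Sum>k\<in>A. M i k * (N \<odot> P) k j)"
    by (simp add: NP)
  also have "\<dots> = (M \<odot> (N \<odot> P)) i j"
    by (rule smat_mult_sum [OF A, symmetric]) (auto simp: A_def)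
  finally show ?thesis .
qed

lemma smat_mult_assoc_row_finite:
  assumes "row_finite M" "row_finite N"
  shows "(M \<odot> N) \<odot> P = M \<odot> (N \<odot> P)"
proof (intro ext smat_mult_assoc_entry)
  fix i j k
  show "finite {k. M i k \<noteq> 0}" using assms by (simp add: row_finite_def)
  show "finite {l. N k l * P l j \<noteq> 0}"
    by (rule finite_subset [of _ "{l. N k l \<noteq> 0}"]) (use assms in \<open>auto simp: row_finite_def\<close>)
qed

text \<open>This version serves products whose middle factor is a moment matrix, which has neither
  finite rows nor finite columns.\<close>

lemma smat_mult_assoc_outer:
  assumes "row_finite M" "row_finite (smat_transpose P)"
  shows "(M \<odot> N) \<odot> P = M \<odot> (N \<odot> P)"
proof (intro ext smat_mult_assoc_entry)
  fix i j k
  show "finite {k. M i k \<noteq> 0}" using assms by (simp add: row_finite_def)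
  show "finite {l. N k l * P l j \<noteq> 0}"
    by (rule finite_subset [of _ "{l. P l j \<noteq> 0}"])
      (use assms in \<open>auto simp: row_finite_def smat_transpose_def\<close>)
qed

lemma smat_mult_assoc_col_finite:
  assumes "row_finite (smat_transpose N)" "row_finite (smat_transpose P)"
  shows "(M \<odot> N) \<odot> P = M \<odot> (N \<odot> P)"
  using smat_mult_assoc_row_finite [OF assms(2,1), of "smat_transpose M"]
  by (metis smat_transpose_mult smat_transpose_transpose)

lemma row_finite_mult:
  assumes "row_finite M" "row_finite N"
  shows "row_finite (M \<odot> N)"
  unfolding row_finite_def
proof
  fix i
  have "{j. (M \<odot> N) i j \<noteq> 0} \<subseteq> (\<Union>k\<in>{k. M i k \<noteq> 0}. {j. N k j \<noteq> 0})"
  proof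
    fix j assume "j \<in> {j. (M \<odot> N) i j \<noteq> 0}"
    then have "Sum_any (\<lambda>k. M i k * N k j) \<noteq> 0" by (simp add: smat_mult_def)
    then obtain k where "M i k * N k j \<noteq> 0" by (rule Sum_any.not_neutral_obtains_not_neutral)
    then show "j \<in> (\<Union>k\<in>{k. M i k \<noteq> 0}. {j. N k j \<noteq> 0})" by auto
  qed
  then show "finite {j. (M \<odot> N) i j \<noteq> 0}"
    by (rule finite_subset) (use assms in \<open>auto simp: row_finite_def\<close>)
qed

lemma smat_mult_diag_left: "(smat_diag d \<odot> M) i j = d i * M i j"
  by (subst smat_mult_sum [of "{i}"]) (auto simp: smat_diag_def)

lemma smat_mult_diag_right: "(M \<odot> smat_diag d) i j = M i j * d j"
  by (subst smat_mult_sum [of "{j}"]) (auto simp: smat_diag_def)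

lemma smat_mult_one [simp]: "smat_one \<odot> M = M" "M \<odot> smat_one = M"
  by (auto simp: fun_eq_iff smat_mult_diag_left smat_mult_diag_right)

lemma smat_mult_diag_inverse:
  assumes "\<And>n. d n \<noteq> 0"
  shows "smat_diag d \<odot> smat_diag (\<lambda>n. inverse (d n)) = smat_one"
    "smat_diag (\<lambda>n. inverse (d n)) \<odot> smat_diag d = smat_one"
  using assms by (simp_all add: fun_eq_iff smat_mult_diag_left) (simp_all add: smat_diag_def)

lemma lower_unitriangular_mult_entry:
  assumes "lower_unitriangular M"
  shows "(M \<odot> N) i j = (\<Sum>k\<le>i. M i k * N k j)"
  by (rule smat_mult_sum) (use assms in \<open>auto simp: lower_unitriangular_def\<close>)

lemma lower_unitriangular_mult:
  assumes "lower_unitriangular M" "lower_unitriangular N"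
  shows "lower_unitriangular (M \<odot> N)"
  unfolding lower_unitriangular_def
proof (intro conjI allI impI)
  fix i
  have "(M \<odot> N) i i = (\<Sum>k\<le>i. if k = i then 1 else 0)"
    unfolding lower_unitriangular_mult_entry [OF assms(1)]
    by (rule sum.cong) (use assms in \<open>auto simp: lower_unitriangular_def\<close>)
  then show "(M \<odot> N) i i = 1" by simp
next
  fix i j :: nat assume "i < j"
  then show "(M \<odot> N) i j = 0"
    unfolding lower_unitriangular_mult_entry [OF assms(1)]
    by (intro sum.neutral) (use assms in \<open>auto simp: lower_unitriangular_def\<close>)
qed

section \<open>Gaussian elimination and the Gauss--Borel factorization\<close>

text \<open>Equivalent to all leading principal sections having trivial left kernel: a nonzero
  kernel vector can be cut off at its last nonzero entry and scaled to make that entry 1.\<close>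

definition nondegenerate :: "smat \<Rightarrow> bool" where
  "nondegenerate g \<longleftrightarrow>
     (\<forall>n c. c n = 1 \<longrightarrow> (\<exists>j\<le>n. (\<Sum>i\<le>n. c i * g i j) \<noteq> 0))"

lemma elimination_row:
  assumes "nondegenerate g"
  shows "\<exists>r. r n = 1 \<and> (\<forall>i>n. r i = 0) \<and> (\<forall>j<n. (\<Sum>i\<le>n. r i * g i j) = 0)"
proof (induction n rule: less_induct)
  case (less n)
  \<comment> \<open>The columns of row \<open>n\<close> are cleared one at a time. Column
    \<open>m\<close> is cleared with the finished row \<open>m\<close> from the outer induction,
    which leaves the earlier columns at 0.\<close>
  have "\<exists>r. r n = 1 \<and> (\<forall>i>n. r i = 0) \<and> (\<forall>j<m. (\<Sum>i\<le>n. r i * g i j) = 0)"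
    if "m \<le> n" for m
    using that
  proof (induction m)
    case 0
    show ?case by (rule exI [of _ "\<lambda>i. if i = n then 1 else 0"]) auto
  next
    case (Suc m)
    then obtain r where r: "r n = 1" "\<forall>i>n. r i = 0" "\<forall>j<m. (\<Sum>i\<le>n. r i * g i j) = 0"
      by auto
    obtain s where s: "s m = 1" "\<forall>i>m. s i = 0" "\<forall>j<m. (\<Sum>i\<le>m. s i * g i j) = 0"
      using less.IH [of m] Suc.prems by auto
    have sn: "(\<Sum>i\<le>n. s i * g i j) = (\<Sum>i\<le>m. s i * g i j)" for j
      by (rule sum.mono_neutral_right) (use Suc.prems s in auto)
    define h where "h = (\<Sum>i\<le>m. s i * g i m)"
    \<comment> \<open>The pivot: \<open>s\<close> has last entry 1 and annihilates the columns
      before \<open>m\<close>, so nondegeneracy leaves only column \<open>m\<close> for a nonzero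
      value.\<close>
    have h: "h \<noteq> 0"
      using assms s(1,3) unfolding h_def nondegenerate_def by (metis le_eq_less_or_eq)
    define t where "t = (\<Sum>i\<le>n. r i * g i m) / h"
    have "(\<Sum>i\<le>n. (r i - t * s i) * g i j) = 0" if "j < Suc m" for j
    proof -
      have "(\<Sum>i\<le>n. (r i - t * s i) * g i j)
          = (\<Sum>i\<le>n. r i * g i j) - t * (\<Sum>i\<le>m. s i * g i j)"
        by (simp add: sn [symmetric] sum_subtractf sum_distrib_left left_diff_distrib mult.assoc)
      also have "\<dots> = 0"
        using that r(3) s(3) h by (cases "j = m") (auto simp: t_def h_def)
      finally show ?thesis .
    qed
    then show ?case
      by (intro exI [of _ "\<lambda>i. r i - t * s i"]) (use r s Suc.prems in auto)
  qed
  from this [of n] show ?case by simp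
qed

lemma elimination:
  assumes "nondegenerate g"
  shows "\<exists>S. lower_unitriangular S \<and> (\<forall>i j. j < i \<longrightarrow> (S \<odot> g) i j = 0) \<and> (\<forall>i. (S \<odot> g) i i \<noteq> 0)"
proof -
  obtain S where S: "\<And>n. S n n = 1" "\<And>n i. n < i \<Longrightarrow> S n i = 0"
      "\<And>n j. j < n \<Longrightarrow> (\<Sum>i\<le>n. S n i * g i j) = 0"
    using elimination_row [OF assms] by metis
  then have lu: "lower_unitriangular S" by (simp add: lower_unitriangular_def)
  have "(\<Sum>i\<le>n. S n i * g i n) \<noteq> 0" for n
    using assms S(1,3) unfolding nondegenerate_def by (metis le_eq_less_or_eq)
  with S lu show ?thesis
    by (intro exI [of _ S]) (auto simp: lower_unitriangular_mult_entry [OF lu])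
qed

section \<open>Inverses of lower unitriangular matrices\<close>

lemma nondegenerate_lower_unitriangular:
  assumes "lower_unitriangular M"
  shows "nondegenerate M"
  unfolding nondegenerate_def
proof (intro allI impI)
  fix n and c :: svec assume "c n = 1"
  have "(\<Sum>i\<le>n. c i * M i n) = (\<Sum>i\<le>n. if i = n then 1 else 0)"
    by (rule sum.cong) (use assms \<open>c n = 1\<close> in \<open>auto simp: lower_unitriangular_def\<close>)
  then show "\<exists>j\<le>n. (\<Sum>i\<le>n. c i * M i j) \<noteq> 0" by (intro exI [of _ n]) simp
qed

text \<open>Elimination makes \<open>N \<odot> M\<close> vanish below the diagonal; as a product of
  lower unitriangular matrices it also vanishes above it and has unit diagonal.\<close>

lemma lower_unitriangular_left_inverse:
  assumes "lower_unitriangular M"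
  shows "\<exists>N. lower_unitriangular N \<and> N \<odot> M = smat_one"
proof -
  obtain N where N: "lower_unitriangular N" "\<And>i j. j < i \<Longrightarrow> (N \<odot> M) i j = 0"
    using elimination [OF nondegenerate_lower_unitriangular [OF assms]] by blast
  have "lower_unitriangular (N \<odot> M)"
    by (rule lower_unitriangular_mult [OF N(1) assms])
  with N have "N \<odot> M = smat_one"
    by (auto simp: fun_eq_iff smat_diag_def lower_unitriangular_def nat_neq_iff)
  with N show ?thesis by blast
qed

text \<open>A left inverse \<open>N\<close> of \<open>M\<close> has itself a left inverse
  \<open>P\<close>. Associativity gives \<open>P = M\<close>, so \<open>N\<close> is two-sided and
  hence unique, which justifies the definite description.\<close>

lemma smat_inv:
  assumes M: "lower_unitriangular M"
  shows "lower_unitriangular (smat_inv M)" "M \<odot> smat_inv M = smat_one" "smat_inv M \<odot> M = smat_one"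
proof -
  obtain N where N: "lower_unitriangular N" "N \<odot> M = smat_one"
    using lower_unitriangular_left_inverse [OF M] by blast
  obtain P where P: "lower_unitriangular P" "P \<odot> N = smat_one"
    using lower_unitriangular_left_inverse [OF N(1)] by blast
  have "P = (P \<odot> N) \<odot> M"
    using smat_mult_assoc_row_finite [of P N M] N P by (simp add: row_finite_lower_unitriangular)
  then have MN: "M \<odot> N = smat_one" using P by simp
  have "\<exists>!N. lower_unitriangular N \<and> M \<odot> N = smat_one \<and> N \<odot> M = smat_one"
  proof (rule ex1I [of _ N])
    fix N' assume N': "lower_unitriangular N' \<and> M \<odot> N' = smat_one \<and> N' \<odot> M = smat_one"
    then have "N' = (N' \<odot> M) \<odot> N"
      using smat_mult_assoc_row_finite [of N' M N] M MN by (simp add: row_finite_lower_unitriangular)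
    then show "N' = N" using N' by simp
  qed (use N MN in simp)
  from theI' [OF this]
  show "lower_unitriangular (smat_inv M)" "M \<odot> smat_inv M = smat_one" "smat_inv M \<odot> M = smat_one"
    by (simp_all add: smat_inv_def)
qed

lemma smat_inv_transpose:
  assumes "lower_unitriangular M"
  shows "smat_transpose (smat_inv M) \<odot> smat_transpose M = smat_one"
    "smat_transpose M \<odot> smat_transpose (smat_inv M) = smat_one"
  using smat_inv(2,3) [OF assms] by (metis smat_transpose_diag smat_transpose_mult)+

lemma smat_inv_eqI:
  assumes "lower_unitriangular M" "lower_unitriangular N" "N \<odot> M = smat_one"
  shows "smat_inv M = N"
proof -
  have "N = N \<odot> (M \<odot> smat_inv M)" by (simp add: smat_inv(2) [OF assms(1)])
  also have "\<dots> = (N \<odot> M) \<odot> smat_inv M"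
    by (intro smat_mult_assoc_row_finite [symmetric] row_finite_lower_unitriangular assms)
  finally show ?thesis by (simp add: assms)
qed

lemma smat_inv_inv:
  assumes "lower_unitriangular M"
  shows "smat_inv (smat_inv M) = M"
  by (rule smat_inv_eqI) (use smat_inv [OF assms] assms in auto)

section \<open>Existence and uniqueness of the factorization\<close>

lemmas smat_row_finite =
  row_finite_lower_unitriangular row_finite_diag row_finite_mult

lemma gauss_borelD:
  assumes "gauss_borel g S H St"
  shows "lower_unitriangular S" "lower_unitriangular St" "H n \<noteq> 0"
    and "S \<odot> g = smat_diag H \<odot> smat_transpose (smat_inv St)"
    and "(S \<odot> g) \<odot> smat_transpose St = smat_diag H"
proof -
  show S: "lower_unitriangular S" and St: "lower_unitriangular St" and "H n \<noteq> 0"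
    using assms by (auto simp: gauss_borel_def)
  note Si = smat_inv [OF S]
  have g: "g = (smat_inv S \<odot> smat_diag H) \<odot> smat_transpose (smat_inv St)"
    using assms by (simp add: gauss_borel_def)
  also have "\<dots> = smat_inv S \<odot> (smat_diag H \<odot> smat_transpose (smat_inv St))"
    by (intro smat_mult_assoc_row_finite smat_row_finite Si)
  finally have "S \<odot> g = S \<odot> (smat_inv S \<odot> (smat_diag H \<odot> smat_transpose (smat_inv St)))"
    by simp
  also have "\<dots> = (S \<odot> smat_inv S) \<odot> (smat_diag H \<odot> smat_transpose (smat_inv St))"
    by (intro smat_mult_assoc_row_finite [symmetric] smat_row_finite Si S)
  finally show Sg: "S \<odot> g = smat_diag H \<odot> smat_transpose (smat_inv St)"
    by (simp add: Si)
  have "(S \<odot> g) \<odot> smat_transpose St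
      = smat_diag H \<odot> (smat_transpose (smat_inv St) \<odot> smat_transpose St)"
    unfolding Sg
    by (intro smat_mult_assoc_outer) (simp_all add: smat_row_finite St)
  then show "(S \<odot> g) \<odot> smat_transpose St = smat_diag H"
    by (simp add: smat_inv_transpose [OF St])
qed

lemma gauss_borel_exists:
  assumes "nondegenerate g"
  shows "\<exists>S H St. gauss_borel g S H St"
proof -
  obtain S where S: "lower_unitriangular S"
      and U: "\<And>i j. j < i \<Longrightarrow> (S \<odot> g) i j = 0" "\<And>i. (S \<odot> g) i i \<noteq> 0"
    using elimination [OF assms] by blast
  define H where "H n = (S \<odot> g) n n" for n
  \<comment> \<open>Dividing the rows of the upper triangular \<open>S \<odot> g\<close> by their
    diagonal entries and transposing gives a lower unitriangular matrix. It plays the role of the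
    inverse of \<open>St\<close>, so the witness for \<open>St\<close> is
    \<open>smat_inv V\<close>.\<close>
  define V where "V i j = (S \<odot> g) j i / H j" for i j
  have V: "lower_unitriangular V"
    using U by (auto simp: lower_unitriangular_def V_def H_def)
  have "g = smat_inv S \<odot> (S \<odot> g)"
    by (simp add: smat_mult_assoc_row_finite [symmetric] smat_row_finite S smat_inv)
  also have "S \<odot> g = smat_diag H \<odot> smat_transpose V"
    using U(2) by (simp add: fun_eq_iff smat_mult_diag_left V_def smat_transpose_def H_def)
  also have "smat_inv S \<odot> (smat_diag H \<odot> smat_transpose V)
      = (smat_inv S \<odot> smat_diag H) \<odot> smat_transpose (smat_inv (smat_inv V))"
    by (simp add: smat_mult_assoc_row_finite smat_row_finite S smat_inv smat_inv_inv V)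
  finally have "gauss_borel g S H (smat_inv V)"
    using S smat_inv(1) [OF V] U(2) by (simp add: gauss_borel_def H_def)
  then show ?thesis by blast
qed

text \<open>The lower triangular \<open>S' S\<inverse>\<close> is, up to the diagonal factors, also upper triangular.\<close>

lemma gauss_borel_unique:
  assumes "gauss_borel g S H St" "gauss_borel g S' H' St'"
  shows "S' = S" "H' = H" "St' = St"
proof -
  note a = gauss_borelD [OF assms(1)] and b = gauss_borelD [OF assms(2)]
  note Si = smat_inv [OF a(1)] and Sti = smat_inv [OF a(2)]
  define D where "D = S' \<odot> smat_inv S"
  define E where "E = St' \<odot> smat_inv St"
  have D: "lower_unitriangular D" unfolding D_def by (intro lower_unitriangular_mult b Si)
  have E: "lower_unitriangular E" unfolding E_def by (intro lower_unitriangular_mult b Sti)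
  have DS: "D \<odot> S = S'"
    by (simp add: D_def smat_mult_assoc_row_finite smat_row_finite a b Si)
  have ES: "E \<odot> St = St'"
    by (simp add: E_def smat_mult_assoc_row_finite smat_row_finite a b Sti)
  \<comment> \<open>Since \<open>D\<close> and \<open>E\<close> carry \<open>S\<close> and
    \<open>St\<close> to \<open>S'\<close> and \<open>St'\<close>, multiplying the diagonalized
    \<open>g\<close> by \<open>D\<close> on the left and by the transpose of \<open>E\<close> on the
    right gives \<open>smat_diag H'\<close>.\<close>
  have "D \<odot> smat_diag H = D \<odot> ((S \<odot> g) \<odot> smat_transpose St)"
    using a by simp
  also have "\<dots> = ((D \<odot> S) \<odot> g) \<odot> smat_transpose St"
    by (simp add: smat_mult_assoc_outer [of D] smat_mult_assoc_row_finite [of D] smat_row_finite D a)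
  finally have "(D \<odot> smat_diag H) \<odot> smat_transpose E
      = (S' \<odot> g) \<odot> (smat_transpose St \<odot> smat_transpose E)"
    by (simp add: DS smat_mult_assoc_col_finite smat_row_finite a E)
  also have "\<dots> = smat_diag H'"
    using b by (simp add: smat_transpose_mult [symmetric] ES)
  finally have "(D \<odot> smat_diag H) \<odot> smat_transpose E \<odot> smat_transpose (smat_inv E)
      = smat_diag H' \<odot> smat_transpose (smat_inv E)" by simp
  moreover have "(D \<odot> smat_diag H) \<odot> smat_transpose E \<odot> smat_transpose (smat_inv E)
      = (D \<odot> smat_diag H) \<odot> (smat_transpose E \<odot> smat_transpose (smat_inv E))"
    by (rule smat_mult_assoc_col_finite) (simp_all add: smat_row_finite E smat_inv)
  ultimately have "D \<odot> smat_diag H = smat_diag H' \<odot> smat_transpose (smat_inv E)"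
    by (simp add: smat_inv_transpose [OF E])
  then have eq: "D i j * H j = H' i * smat_inv E j i" for i j
    by (metis smat_mult_diag_left smat_mult_diag_right smat_transpose_def)
  note F = lower_unitriangularD [OF smat_inv(1) [OF E]] and D' = lower_unitriangularD [OF D]
  show H: "H' = H"
  proof
    fix n show "H' n = H n" using eq [of n n] by (simp add: F D')
  qed
  have "D = smat_one"
  proof (intro ext)
    fix i j :: nat
    consider "i < j" | "i = j" | "j < i" by linarith
    then show "D i j = smat_one i j"
      using eq [of i j] a(3) [of j] by cases (auto simp: F D' smat_diag_def)
  qed
  then show "S' = S" using DS by simp
  have "smat_inv E = smat_one"
  proof (intro ext)
    fix i j :: nat
    consider "i < j" | "i = j" | "j < i" by linarith
    then show "smat_inv E i j = smat_one i j"
      using eq [of j i] b(3) [of j] by cases (auto simp: F D' smat_diag_def)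
  qed
  then have "E = smat_one" using smat_inv(2) [OF E] by simp
  then show "St' = St" using ES by simp
qed

section \<open>The Jacobi--Pineiro moments\<close>

text \<open>The power of \<open>x\<close> in entry \<open>j\<close> of the weighted vector of
  monomials. It merges both weights into one sequence, so that every moment is a single Beta
  value.\<close>

definition jp_exponent :: "real \<Rightarrow> real \<Rightarrow> nat \<Rightarrow> real" where
  "jp_exponent \<alpha> \<beta> j = (if even j then \<alpha> else \<beta>) + real (j div 2)"

text \<open>The exponents run through \<alpha>, \<beta>, \<alpha>+1, \<beta>+1, ...; dropping the
  first leaves the sequence of the new system. This is why the transformation deletes a
  column.\<close>

lemma jp_exponent_shift: "jp_exponent \<beta> (\<alpha> + 1) j = jp_exponent \<alpha> \<beta> (Suc j)"
  by (auto simp: jp_exponent_def elim!: evenE oddE)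

lemma jp_exponent_gt:
  assumes "\<alpha> > -1" "\<beta> > -1"
  shows "jp_exponent \<alpha> \<beta> j > -1"
  using assms by (simp add: jp_exponent_def add.commute add_strict_increasing)

text \<open>Coinciding exponents of different parity would make \<alpha>-\<beta> an integer; within
  one parity the integer parts \<open>j div 2\<close> differ.\<close>

lemma inj_jp_exponent:
  assumes "\<alpha> - \<beta> \<notin> \<int>"
  shows "inj (jp_exponent \<alpha> \<beta>)"
proof
  fix i j assume eq: "jp_exponent \<alpha> \<beta> i = jp_exponent \<alpha> \<beta> j"
  have same: "even i = even j"
  proof (rule ccontr)
    assume "even i \<noteq> even j"
    with eq have "\<alpha> - \<beta> = of_int (int (j div 2) - int (i div 2)) \<or>
        \<alpha> - \<beta> = of_int (int (i div 2) - int (j div 2))"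
      by (auto simp: jp_exponent_def split: if_splits)
    then show False using assms by (metis Ints_of_int)
  qed
  with eq have "i div 2 = j div 2"
    by (auto simp: jp_exponent_def split: if_splits)
  with same show "i = j" by (metis bit_eq_rec)
qed

lemma jp_moment_eq_Beta:
  assumes "\<alpha> > -1" "\<beta> > -1" "\<gamma> > -1"
  shows "jp_moment \<alpha> \<beta> \<gamma> i j = Beta (jp_exponent \<alpha> \<beta> j + 1 + real i) (\<gamma> + 1)"
proof -
  let ?s = "jp_exponent \<alpha> \<beta> j + real i"
  have int: "((\<lambda>x. x powr ?s * (1 - x) powr \<gamma>) has_integral Beta (?s + 1) (\<gamma> + 1)) {0..1}"
    using has_integral_Beta_real [of "?s + 1" "\<gamma> + 1"] jp_exponent_gt [OF assms(1,2), of j] assms(3)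
    by simp
  have "X_vec x i * (X1_vec x j * x powr \<alpha> + X2_vec x j * x powr \<beta>) * (1 - x) powr \<gamma>
      = x powr ?s * (1 - x) powr \<gamma>" if "x \<in> {0..1}" for x
  \<comment> \<open>At \<open>x = 0\<close> both sides are 0, because \<open>0 powr a = 0\<close>
    for every \<open>a\<close>, negative exponents included.\<close>
  proof (cases "x = 0")
    case False
    with that have "x > 0" by simp
    then show ?thesis
      by (simp add: X_vec_def X1_vec_def X2_vec_def jp_exponent_def powr_add powr_realpow mult_ac)
  qed (auto simp: X_vec_def)
  then have "jp_moment \<alpha> \<beta> \<gamma> i j = integral {0..1} (\<lambda>x. x powr ?s * (1 - x) powr \<gamma>)"
    unfolding jp_moment_def by (intro integral_cong)
  with int show ?thesis by (simp add: integral_unique add_ac)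
qed

section \<open>Linear independence of rows of Beta values\<close>

lemma Beta_add_nat:
  fixes a b :: real
  assumes "a > 0" "b > 0"
  shows "pochhammer (a + b) n * Beta (a + real n) b = pochhammer a n * Beta a b"
proof (induction n)
  case (Suc n)
  have "a + real n \<notin> \<int>\<^sub>\<le>\<^sub>0" using assms by (auto elim!: nonpos_Ints_cases)
  from Beta_plus1_left [OF this, of b]
  have "(a + b + real n) * Beta (a + real (Suc n)) b = (a + real n) * Beta (a + real n) b"
    by (simp add: algebra_simps)
  then have "pochhammer (a + b) (Suc n) * Beta (a + real (Suc n)) b
      = (a + real n) * (pochhammer (a + b) n * Beta (a + real n) b)"
    by (simp add: pochhammer_Suc mult.assoc)
  then show ?case using Suc.IH by (simp add: pochhammer_Suc mult_ac)
qed simp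

lemma poly_pochhammer_linear: "poly (pochhammer [:c, 1:] k) x = pochhammer (x + c) k"
  for c x :: real
  by (induction k) (simp_all add: pochhammer_Suc of_nat_poly algebra_simps)

lemma degree_pochhammer_linear: "degree (pochhammer [:c, 1:] k) \<le> k" for c :: real
proof (induction k)
  case (Suc k)
  have "degree (pochhammer [:c, 1:] k * ([:c, 1:] + of_nat k)) \<le> k + 1"
    by (rule order_trans [OF degree_mult_le add_mono [OF Suc.IH]]) (simp add: of_nat_poly)
  then show ?case by (simp add: pochhammer_Suc)
qed simp

text \<open>
  Clearing denominators in \<open>B(a + i, b) = B(a, b) (a)\<^sub>i / (a + b)\<^sub>i\<close> turns a vanishing
  combination of rows into a polynomial in \<open>a\<close> of degree at most \<open>n\<close> with \<open>n + 1\<close> distinct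
  roots. Its values at \<open>a = 0, -1, -2, \<dots>\<close> then give the coefficients successively.
\<close>

lemma Beta_rows_independent:
  fixes a :: "nat \<Rightarrow> real"
  assumes inj: "inj a" and a: "\<And>j. a j > 0" and b: "b > 0"
    and c: "\<And>j. j \<le> n \<Longrightarrow> (\<Sum>i\<le>n. c i * Beta (a j + real i) b) = 0"
    and "k \<le> n"
  shows "c k = 0"
proof -
  \<comment> \<open>The common denominator is \<open>pochhammer (x + b) n\<close>; splitting it
    after \<open>i\<close> factors leaves the cofactor
    \<open>pochhammer (x + b + real i) (n - i)\<close>.\<close>
  define p where "p = (\<Sum>i\<le>n. smult (c i) (pochhammer [:0, 1:] i * pochhammer [:b + real i, 1:] (n - i)))"
  have poly_p: "poly p x = (\<Sum>i\<le>n. c i * (pochhammer x i * pochhammer (x + b + real i) (n - i)))" for x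
    by (simp add: p_def poly_sum poly_pochhammer_linear add.assoc)
  have root: "poly p (a j) = 0" if "j \<le> n" for j
  proof -
    have scaled: "Beta (a j) b * (pochhammer (a j) i * pochhammer (a j + b + real i) (n - i))
        = pochhammer (a j + b) n * Beta (a j + real i) b" if "i \<le> n" for i
      using Beta_add_nat [OF a b, of j i] pochhammer_product [OF that, of "a j + b"]
      by (simp add: mult_ac)
    have "Beta (a j) b * poly p (a j)
        = (\<Sum>i\<le>n. c i * (Beta (a j) b * (pochhammer (a j) i * pochhammer (a j + b + real i) (n - i))))"
      by (simp add: poly_p sum_distrib_left mult_ac)
    also have "\<dots> = (\<Sum>i\<le>n. c i * (pochhammer (a j + b) n * Beta (a j + real i) b))"
      by (rule sum.cong) (auto simp: scaled)
    also have "\<dots> = pochhammer (a j + b) n * (\<Sum>i\<le>n. c i * Beta (a j + real i) b)"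
      by (simp add: sum_distrib_left mult_ac)
    finally have "Beta (a j) b * poly p (a j) = 0" using c [OF that] by simp
    moreover have "Beta (a j) b > 0"
      using a [of j] b by (simp add: Beta_def)
    ultimately show ?thesis by simp
  qed
  have deg: "degree p \<le> n"
    unfolding p_def
  proof (rule degree_sum_le)
    fix i assume "i \<in> {..n}"
    then have "degree (pochhammer [:0, 1:] i * pochhammer [:b + real i, 1:] (n - i)) \<le> i + (n - i)"
      by (intro order_trans [OF degree_mult_le] add_mono degree_pochhammer_linear)
    with \<open>i \<in> {..n}\<close> show "degree (smult (c i) (pochhammer [:0, 1:] i * pochhammer [:b + real i, 1:] (n - i))) \<le> n"
      by (intro order_trans [OF degree_smult_le]) simp
  qed simp
  have p0: "p = 0"
  proof (rule ccontr)
    assume "p \<noteq> 0"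
    have "card (a ` {..n}) \<le> card {x. poly p x = 0}"
      by (rule card_mono) (use root poly_roots_finite [OF \<open>p \<noteq> 0\<close>] in auto)
    also have "\<dots> \<le> degree p" by (rule card_poly_roots_bound [OF \<open>p \<noteq> 0\<close>])
    also have "card (a ` {..n}) = Suc n"
      using inj by (simp add: card_image inj_on_subset)
    finally show False using deg by simp
  qed
  show "c k = 0"
    using \<open>k \<le> n\<close>
  proof (induction k rule: less_induct)
    case (less k)
    \<comment> \<open>At the point \<open>- real k\<close> the terms with \<open>i > k\<close>
      contain a factor 0 and those with \<open>i < k\<close> vanish by induction. In the term
      \<open>i = k\<close> the second Pochhammer argument is \<open>b > 0\<close>, so its cofactor
      is nonzero.\<close>
    let ?t = "\<lambda>i. c i * (pochhammer (- real k) i * pochhammer (- real k + b + real i) (n - i))"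
    have "0 = (\<Sum>i\<le>n. ?t i)" using poly_p [of "- real k"] p0 by simp
    also have "\<dots> = (\<Sum>i\<in>{k}. ?t i)"
    proof (rule sum.mono_neutral_right)
      show "\<forall>i\<in>{..n} - {k}. ?t i = 0"
      proof
        fix i assume "i \<in> {..n} - {k}"
        then consider "i < k" | "k < i" by fastforce
        then show "?t i = 0"
          by cases (use less in \<open>auto simp: pochhammer_of_nat_eq_0_lemma\<close>)
      qed
    qed (use less in auto)
    finally have "c k * (pochhammer (- real k) k * pochhammer b (n - k)) = 0"
      by simp
    moreover have "pochhammer (- real k) k \<noteq> 0"
      by (simp add: pochhammer_same)
    moreover have "pochhammer b (n - k) \<noteq> 0"
      using pochhammer_pos [OF b, of "n - k"] by simp
    ultimately show "c k = 0" by simp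
  qed
qed

lemma nondegenerate_jp_moment:
  assumes "\<alpha> > -1" "\<beta> > -1" "\<gamma> > -1" "\<alpha> - \<beta> \<notin> \<int>"
  shows "nondegenerate (jp_moment \<alpha> \<beta> \<gamma>)"
  unfolding nondegenerate_def
proof (intro allI impI, rule ccontr)
  fix n and c :: svec
  assume cn: "c n = 1" and "\<not> (\<exists>j\<le>n. (\<Sum>i\<le>n. c i * jp_moment \<alpha> \<beta> \<gamma> i j) \<noteq> 0)"
  then have "(\<Sum>i\<le>n. c i * Beta (jp_exponent \<alpha> \<beta> j + 1 + real i) (\<gamma> + 1)) = 0" if "j \<le> n" for j
    using that by (simp add: jp_moment_eq_Beta assms)
  moreover have "inj (\<lambda>j. jp_exponent \<alpha> \<beta> j + 1)"
    using inj_jp_exponent [OF assms(4)] by (simp add: inj_def)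
  moreover have "jp_exponent \<alpha> \<beta> j + 1 > 0" for j
    using jp_exponent_gt [OF assms(1,2), of j] by simp
  ultimately have "c n = 0"
    using assms(3) by (intro Beta_rows_independent [of "\<lambda>j. jp_exponent \<alpha> \<beta> j + 1" "\<gamma> + 1" n c]) auto
  with cn show False by simp
qed

text \<open>Existence and uniqueness together make the three definite descriptions denote the
  factors of one and the same factorization.\<close>

lemma gauss_borel_jp:
  assumes "\<alpha> > -1" "\<beta> > -1" "\<gamma> > -1" "\<alpha> - \<beta> \<notin> \<int>"
  shows "gauss_borel (jp_moment \<alpha> \<beta> \<gamma>) (jp_S \<alpha> \<beta> \<gamma>) (jp_H \<alpha> \<beta> \<gamma>) (jp_St \<alpha> \<beta> \<gamma>)"
proof -
  obtain S H St where gb: "gauss_borel (jp_moment \<alpha> \<beta> \<gamma>) S H St"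
    using gauss_borel_exists [OF nondegenerate_jp_moment [OF assms]] by blast
  note u = gauss_borel_unique [OF gb]
  have "jp_S \<alpha> \<beta> \<gamma> = S" unfolding jp_S_def by (rule the_equality) (use gb u in blast)+
  moreover have "jp_H \<alpha> \<beta> \<gamma> = H" unfolding jp_H_def by (rule the_equality) (use gb u in blast)+
  moreover have "jp_St \<alpha> \<beta> \<gamma> = St" unfolding jp_St_def by (rule the_equality) (use gb u in blast)+
  ultimately show ?thesis using gb by simp
qed

section \<open>The connection matrix\<close>

definition smat_shift :: smat where
  "smat_shift = (\<lambda>i j. if j = Suc i then 1 else 0)"

lemma row_finite_shift: "row_finite smat_shift"
  unfolding row_finite_def
proof
  fix i
  have "{k. smat_shift i k \<noteq> 0} \<subseteq> {Suc i}" by (auto simp: smat_shift_def)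
  then show "finite {k. smat_shift i k \<noteq> 0}" by (rule finite_subset) simp
qed

lemma smat_mult_shift_left: "(smat_shift \<odot> M) i j = M (Suc i) j"
  by (subst smat_mult_sum [of "{Suc i}"]) (auto simp: smat_shift_def)

lemma smat_mult_transpose_shift: "(M \<odot> smat_transpose smat_shift) i j = M i (Suc j)"
  by (subst smat_mult_sum [of "{Suc j}"]) (auto simp: smat_shift_def smat_transpose_def)

lemma jp_moment_shift:
  assumes "\<alpha> > -1" "\<beta> > -1" "\<gamma> > -1"
  shows "jp_moment \<beta> (\<alpha> + 1) \<gamma> = jp_moment \<alpha> \<beta> \<gamma> \<odot> smat_transpose smat_shift"
  using assms
  by (simp add: fun_eq_iff smat_mult_transpose_shift jp_moment_eq_Beta jp_exponent_shift)

text \<open>With \<open>M = St\<close> and \<open>N = St'\<close> this is the matrix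
  \<open>F\<close> of the overview.\<close>

definition smat_hessenberg :: "smat \<Rightarrow> smat \<Rightarrow> smat" where
  "smat_hessenberg M N = (N \<odot> smat_shift) \<odot> smat_inv M"

text \<open>Both sides below are the product \<open>S g \<Lambda>\<^sup>T St'\<^sup>T\<close> for the shifted moment matrix \<open>g \<Lambda>\<^sup>T\<close>.\<close>

lemma gauss_borel_shift:
  assumes gb: "gauss_borel g S H St"
    and gb': "gauss_borel (g \<odot> smat_transpose smat_shift) S' H' St'"
  shows "(S \<odot> smat_inv S') \<odot> smat_diag H' = smat_diag H \<odot> smat_transpose (smat_hessenberg St St')"
proof -
  note a = gauss_borelD [OF gb] and b = gauss_borelD [OF gb']
  define \<Omega> where "\<Omega> = S \<odot> smat_inv S'"
  have \<Omega>: "lower_unitriangular \<Omega>"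
    unfolding \<Omega>_def by (intro lower_unitriangular_mult smat_inv(1) a(1) b(1))
  have \<Omega>S: "\<Omega> \<odot> S' = S"
    by (simp add: \<Omega>_def smat_mult_assoc_row_finite smat_row_finite a b smat_inv)
  have "\<Omega> \<odot> smat_diag H'
      = ((\<Omega> \<odot> S') \<odot> (g \<odot> smat_transpose smat_shift)) \<odot> smat_transpose St'"
    unfolding b(5) [symmetric]
    by (simp add: smat_mult_assoc_outer [of \<Omega>] smat_mult_assoc_row_finite [of \<Omega>] smat_row_finite \<Omega> b(1,2))
  also have "\<dots> = ((S \<odot> g) \<odot> smat_transpose smat_shift) \<odot> smat_transpose St'"
    unfolding \<Omega>S
    by (simp add: smat_mult_assoc_outer [of S] smat_row_finite a(1) row_finite_shift)
  also have "\<dots> = smat_diag H \<odot> (smat_transpose (smat_inv St)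
      \<odot> (smat_transpose smat_shift \<odot> smat_transpose St'))"
    unfolding a(4)
    by (simp add: smat_mult_assoc_col_finite smat_mult_assoc_outer smat_transpose_mult
        smat_row_finite a b row_finite_shift)
  finally show ?thesis
    by (simp add: \<Omega>_def smat_hessenberg_def smat_transpose_mult)
qed

lemma smat_hessenberg_entry:
  assumes "lower_unitriangular M" "lower_unitriangular N"
  shows "smat_hessenberg M N i j = (\<Sum>k\<le>i. N i k * smat_inv M (Suc k) j)"
  using assms
  by (simp add: smat_hessenberg_def smat_mult_assoc_row_finite smat_row_finite row_finite_shift
      lower_unitriangular_mult_entry smat_mult_shift_left)

text \<open>Row \<open>i\<close> combines rows 1 to \<open>i + 1\<close> of
  \<open>smat_inv M\<close>, none of which reaches beyond column \<open>i + 1\<close>. Only the last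
  one reaches that column, with its unit diagonal entry, which yields the superdiagonal in the next
  lemma.\<close>

lemma smat_hessenberg_zero:
  assumes M: "lower_unitriangular M" and N: "lower_unitriangular N" and "Suc i < j"
  shows "smat_hessenberg M N i j = 0"
  unfolding smat_hessenberg_entry [OF M N]
  by (rule sum.neutral) (use assms smat_inv(1) [OF M] in \<open>auto simp: lower_unitriangular_def\<close>)

lemma smat_hessenberg_superdiag:
  assumes M: "lower_unitriangular M" and N: "lower_unitriangular N"
  shows "smat_hessenberg M N i (Suc i) = 1"
proof -
  have "smat_hessenberg M N i (Suc i) = (\<Sum>k\<le>i. if k = i then 1 else 0)"
    unfolding smat_hessenberg_entry [OF M N]
    by (rule sum.cong) (use N smat_inv(1) [OF M] in \<open>auto simp: lower_unitriangular_def\<close>)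
  then show ?thesis by simp
qed

section \<open>Action of matrices on vectors\<close>

lemma smat_vec_conv_mult: "smat_vec M v i = (M \<odot> (\<lambda>k _. v k)) i j"
  by (simp add: smat_vec_def smat_mult_def)

text \<open>A vector is regarded as a matrix with all columns equal, so associativity carries over
  from matrix products.\<close>

lemma smat_vec_mult:
  assumes "row_finite M" "row_finite N"
  shows "smat_vec (M \<odot> N) v = smat_vec M (smat_vec N v)"
proof
  fix i
  have "smat_vec (M \<odot> N) v i = (M \<odot> (N \<odot> (\<lambda>k _. v k))) i 0"
    by (simp add: smat_vec_conv_mult [where j = 0] smat_mult_assoc_row_finite assms)
  also have "N \<odot> (\<lambda>k _. v k) = (\<lambda>k _. smat_vec N v k)"
    by (simp add: smat_vec_def smat_mult_def)
  finally show "smat_vec (M \<odot> N) v i = smat_vec M (smat_vec N v) i"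
    by (simp add: smat_vec_conv_mult [where j = 0])
qed

lemma smat_vec_sum:
  assumes "row_finite M"
  shows "smat_vec M v i = (\<Sum>k | M i k \<noteq> 0. M i k * v k)"
  unfolding smat_vec_def
  by (rule Sum_any.expand_superset) (use assms in \<open>auto simp: row_finite_def\<close>)

lemma smat_vec_linear:
  assumes "row_finite M"
  shows "smat_vec M (\<lambda>k. a * v k + b * w k) = (\<lambda>i. a * smat_vec M v i + b * smat_vec M w i)"
  by (simp add: fun_eq_iff smat_vec_sum [OF assms] sum.distrib sum_distrib_left algebra_simps)

lemma smat_vec_scale:
  assumes "row_finite M"
  shows "smat_vec M (\<lambda>k. a * v k) = (\<lambda>i. a * smat_vec M v i)"
  using smat_vec_linear [OF assms, of a v 0 v] by simp

lemma smat_vec_shift: "smat_vec smat_shift v = (\<lambda>i. v (Suc i))"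
  by (simp add: fun_eq_iff smat_vec_conv_mult [where j = 0] smat_mult_shift_left)

lemma smat_shift_X1: "smat_vec smat_shift (X1_vec x) = (\<lambda>n. x * X2_vec x n)"
  by (auto simp: smat_vec_shift X1_vec_def X2_vec_def fun_eq_iff elim!: oddE)

lemma smat_shift_X2: "smat_vec smat_shift (X2_vec x) = X1_vec x"
  by (auto simp: smat_vec_shift X1_vec_def X2_vec_def fun_eq_iff elim!: evenE)

theorem theorem8:
  fixes \<alpha> \<beta> \<gamma> :: real and \<Omega> :: smat
  assumes "\<alpha> > -1" and "\<beta> > -1" and "\<gamma> > -1"
    and "\<alpha> - \<beta> \<notin> \<int>"
  defines "\<Omega> \<equiv> jp_connection \<alpha> \<beta> \<gamma>"
  shows "(\<forall>n. \<Omega> n n = 1) \<and>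
    (\<forall>n. \<Omega> (n + 1) n = jp_H \<alpha> \<beta> \<gamma> (n + 1) / jp_H \<beta> (\<alpha> + 1) \<gamma> n) \<and>
    (\<forall>i j. i \<noteq> j \<longrightarrow> i \<noteq> j + 1 \<longrightarrow> \<Omega> i j = 0) \<and>
    (\<forall>x. smat_vec \<Omega> (jp_B \<beta> (\<alpha> + 1) \<gamma> x) = jp_B \<alpha> \<beta> \<gamma> x) \<and>
    (\<forall>x. smat_vec (smat_transpose \<Omega>) (jp_A1 \<alpha> \<beta> \<gamma> x) = (\<lambda>n. x * jp_A2 \<beta> (\<alpha> + 1) \<gamma> x n)) \<and>
    (\<forall>x. smat_vec (smat_transpose \<Omega>) (jp_A2 \<alpha> \<beta> \<gamma> x) = jp_A1 \<beta> (\<alpha> + 1) \<gamma> x) \<and>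
    (\<forall>x>0. smat_vec (smat_transpose \<Omega>) (jp_Q \<alpha> \<beta> \<gamma> x) = jp_Q \<beta> (\<alpha> + 1) \<gamma> x)"
proof -
  define S where "S = jp_S \<alpha> \<beta> \<gamma>"
  define H where "H = jp_H \<alpha> \<beta> \<gamma>"
  define St where "St = jp_St \<alpha> \<beta> \<gamma>"
  define S' where "S' = jp_S \<beta> (\<alpha> + 1) \<gamma>"
  define H' where "H' = jp_H \<beta> (\<alpha> + 1) \<gamma>"
  define St' where "St' = jp_St \<beta> (\<alpha> + 1) \<gamma>"
  have "\<beta> - (\<alpha> + 1) \<notin> \<int>"
  proof
    assume "\<beta> - (\<alpha> + 1) \<in> \<int>"
    then obtain k where "\<beta> - (\<alpha> + 1) = of_int k" by (elim Ints_cases)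
    then have "\<alpha> - \<beta> = of_int (- k - 1)" by simp
    with assms(4) show False by (metis Ints_of_int)
  qed
  then have gb': "gauss_borel (jp_moment \<alpha> \<beta> \<gamma> \<odot> smat_transpose smat_shift) S' H' St'"
    using gauss_borel_jp [of \<beta> "\<alpha> + 1" \<gamma>] jp_moment_shift [OF assms(1-3)] assms(1-3)
    by (simp add: S'_def H'_def St'_def)
  have gb: "gauss_borel (jp_moment \<alpha> \<beta> \<gamma>) S H St"
    using gauss_borel_jp [OF assms(1-4)] by (simp add: S_def H_def St_def)
  note a = gauss_borelD [OF gb] and b = gauss_borelD [OF gb']
  define F where "F = smat_hessenberg St St'"
  have \<Omega>_eq: "\<Omega> = S \<odot> smat_inv S'"
    by (simp add: \<Omega>_def jp_connection_def S_def S'_def)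
  have \<Omega>: "lower_unitriangular \<Omega>"
    unfolding \<Omega>_eq by (intro lower_unitriangular_mult smat_inv(1) a(1) b(1))
  have "\<Omega> \<odot> smat_diag H' = smat_diag H \<odot> smat_transpose F"
    unfolding \<Omega>_eq F_def by (rule gauss_borel_shift [OF gb gb'])
  then have "\<Omega> i j * H' j = H i * F j i" for i j
    by (metis smat_mult_diag_left smat_mult_diag_right smat_transpose_def)
  then have entry: "\<Omega> i j = H i * F j i / H' j" for i j
    using b(3) [of j] by (simp add: field_simps)
  have sub: "\<Omega> (n + 1) n = H (n + 1) / H' n" for n
    by (simp add: entry F_def smat_hessenberg_superdiag a b)
  \<comment> \<open>Above the diagonal this is unitriangularity of \<Omega>; below the subdiagonal
    it is the Hessenberg shape of \<open>F\<close>, which enters transposed.\<close>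
  have band: "\<Omega> i j = 0" if "i \<noteq> j" "i \<noteq> j + 1" for i j
  proof (cases "i < j")
    case True
    then show ?thesis using \<Omega> by (simp add: lower_unitriangular_def)
  next
    case False
    with that have "Suc j < i" by simp
    then show ?thesis by (simp add: entry F_def smat_hessenberg_zero a b)
  qed

  have \<Omega>S: "\<Omega> \<odot> S' = S"
    by (simp add: \<Omega>_eq smat_mult_assoc_row_finite smat_row_finite a b smat_inv)
  have B: "smat_vec \<Omega> (jp_B \<beta> (\<alpha> + 1) \<gamma> x) = jp_B \<alpha> \<beta> \<gamma> x" for x
    unfolding jp_B_def S_def [symmetric] S'_def [symmetric]
    by (simp add: smat_vec_mult [symmetric] smat_row_finite \<Omega> b(1) \<Omega>S)

  let ?D = "smat_diag (\<lambda>n. inverse (H n))" and ?D' = "smat_diag (\<lambda>n. inverse (H' n))"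
  have \<Omega>T: "smat_transpose \<Omega> = (?D' \<odot> F) \<odot> smat_diag H"
    by (simp add: fun_eq_iff smat_transpose_def entry smat_mult_diag_left smat_mult_diag_right
        field_simps)
  have F: "row_finite F"
    unfolding F_def smat_hessenberg_def
    by (intro row_finite_mult row_finite_shift row_finite_lower_unitriangular smat_inv(1) a(2) b(2))
  have \<Omega>T_fin: "row_finite (smat_transpose \<Omega>)"
    unfolding \<Omega>T by (intro row_finite_mult row_finite_diag F)
  \<comment> \<open>The trailing \<open>smat_inv St\<close> in \<open>F\<close> cancels against
    \<open>St\<close>.\<close>
  have FSt: "F \<odot> St = St' \<odot> smat_shift"
    by (simp add: F_def smat_hessenberg_def smat_mult_assoc_row_finite smat_row_finite
        row_finite_shift a b smat_inv)
  \<comment> \<open>The factor \<open>smat_diag H\<close> of the transposed \<Omega> meets its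
    inverse \<open>?D\<close>, so the coefficient matrix of the old linear forms is carried to that
    of the new ones times the shift.\<close>
  have "smat_transpose \<Omega> \<odot> (?D \<odot> St) = (?D' \<odot> F) \<odot> ((smat_diag H \<odot> ?D) \<odot> St)"
    unfolding \<Omega>T
    by (simp add: smat_mult_assoc_row_finite smat_row_finite F a(2))
  also have "\<dots> = (?D' \<odot> St') \<odot> smat_shift"
    by (simp add: smat_mult_diag_inverse a(3) smat_mult_assoc_row_finite smat_row_finite F FSt b(2))
  finally have intertwine: "smat_transpose \<Omega> \<odot> (?D \<odot> St) = (?D' \<odot> St') \<odot> smat_shift" .
  have A: "smat_vec (smat_transpose \<Omega>) (smat_vec (?D \<odot> St) v)
      = smat_vec (?D' \<odot> St') (smat_vec smat_shift v)" for v
    by (simp add: smat_vec_mult [symmetric] intertwine \<Omega>T_fin smat_row_finite row_finite_shift a(2) b(2))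
  have A1: "smat_vec (smat_transpose \<Omega>) (jp_A1 \<alpha> \<beta> \<gamma> x) = (\<lambda>n. x * jp_A2 \<beta> (\<alpha> + 1) \<gamma> x n)" for x
    unfolding jp_A1_def jp_A2_def H_def [symmetric] St_def [symmetric] H'_def [symmetric] St'_def [symmetric]
    by (simp add: A smat_shift_X1 smat_vec_scale smat_row_finite b(2))
  have A2: "smat_vec (smat_transpose \<Omega>) (jp_A2 \<alpha> \<beta> \<gamma> x) = jp_A1 \<beta> (\<alpha> + 1) \<gamma> x" for x
    unfolding jp_A1_def jp_A2_def H_def [symmetric] St_def [symmetric] H'_def [symmetric] St'_def [symmetric]
    by (simp add: A smat_shift_X2)
  \<comment> \<open>The factor \<open>x\<close> from \<open>A1\<close> turns
    \<open>x powr \<alpha>\<close> into \<open>x powr (\<alpha> + 1)\<close>, and the two summands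
    of \<open>jp_Q\<close> change places.\<close>
  have Q: "smat_vec (smat_transpose \<Omega>) (jp_Q \<alpha> \<beta> \<gamma> x) = jp_Q \<beta> (\<alpha> + 1) \<gamma> x" if "x > 0" for x
    using that unfolding jp_Q_def smat_vec_linear [OF \<Omega>T_fin]
    by (simp add: A1 A2 fun_eq_iff powr_add)
  show ?thesis
    using lower_unitriangularD(1) [OF \<Omega>] sub band B A1 A2 Q by (simp add: H_def H'_def)
qed

end
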